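(* If a topological dynamical system has the almost specification property, then it has the vague specification property.
   Context: $\mathbb{N}_0=\{0,1,2,\ldots\}$, $\mathbb{N}=\{1,2,\ldots\}$. A topological dynamical system $(X,T)$ consists of a compact metrizable space $X$ and a continuous map $T\colon X\to X$. Fix a compatible metric $\rho$ on $X$ of diameter at most $1$ (the notions below do not depend on this choice). Almost specification property: a mistake function is a function $g\colon\mathbb{N}\times(0,\varepsilon_0]\to\mathbb{N}$, for some $\varepsilon_0>0$, such that for every $\varepsilon\in(0,\varepsilon_0]$ one has $g(n,\varepsilon)\le g(n+1,\varepsilon)$ for all $n$ and $\lim_{n\to\infty}g(n,\varepsilon)/n=0$; for $\varepsilon>\varepsilon_0$ put $g(n,\varepsilon)=g(n,\varepsilon_0)$. For $x\in X$, $\varepsilon>0$ and $n$ large enough that $g(n,\varepsilon)<n$, let $B_n(g;x,\varepsilon)$ be the set of $y\in X$ for which there is $\Lambda\subseteq\{0,1,\ldots,n-1\}$ with $|\Lambda|\ge n-g(n,\varepsilon)$ and $\rho(T^j(x),T^j(y))\le\varepsilon$ for all $j\in\Lambda$. The system $(X,T)$ has the almost specification property if there are a mistake function $g$ and a function $k_g\colon(0,\infty)\to\mathbb{N}$ (with $g(n,\varepsilon)<n$ for $n\ge k_g(\varepsilon)$) such that for every $m\in\mathbb{N}$, all $\varepsilon_1,\ldots,\varepsilon_m>0$, all $x_1,\ldots,x_m\in X$ and all integers $n_1\ge k_g(\varepsilon_1),\ldots,n_m\ge k_g(\varepsilon_m)$, setting $n_0=0$, $$\bigcap_{j=1}^m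 T^{-(n_0+n_1+\cdots+n_{j-1})}\big(B_{n_j}(g;x_j,\varepsilon_j)\big)\ne\emptyset.$$ For $A\subseteq\mathbb{N}_0$ we write $d(A)=1$ if $\lim_{n\to\infty}\frac{|A\cap[0,n)|}{n}=1$. $X^\infty$ is the set of all sequences $\underline{x}=\{x_n\}_{n=0}^\infty$ in $X$, with the product topology; $S(\underline{x})=\{x_{n+1}\}_{n=0}^\infty$ is the shift on $X^\infty$. Let $\Gamma_T=\{\{T^n(z)\}_{n=0}^\infty : z\in X\}\subseteq X^\infty$. Vague pseudo-orbit: $\underline{x}\in X^\infty$ such that for every open set $\mathcal{U}\subseteq X^\infty$ containing $\Gamma_T$ one has $d(\{n\in\mathbb{N}_0 : S^n(\underline{x})\in\mathcal{U}\})=1$. Vague specification property: for every vague pseudo-orbit $\underline{x}$ in $(X,T)$ there is $z\in X$ such that for every $\varepsilon>0$, $d(\{n\in\mathbb{N}_0 : \rho(T^n(z),x_n)<\varepsilon\})=1$. *)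

theory Defs
  imports "HOL-Analysis.Analysis"
begin

text \<open>
  The phase space is the universe of a type \<open>'a\<close> of class metric_space, with \<open>dist\<close> as the
  compatible metric. The space of sequences is the type \<open>nat \<Rightarrow> 'a\<close>, on which the
  instance of class topological_space for function types is the product topology.
\<close>

definition topological_dynamical_system :: "('a::topological_space \<Rightarrow> 'a) \<Rightarrow> bool" where
  "topological_dynamical_system T \<longleftrightarrow> compact (UNIV :: 'a set) \<and> continuous_on UNIV T"


subsection \<open>Almost specification\<close>

text \<open>
  The first argument of a mistake function ranges over the positive integers and its values are
  positive; the value at \<open>0\<close> is junk. The last conjunct is the extension of the function
  from \<open>(0, \<epsilon>\<^sub>0]\<close> to all positive reals.
\<close>

definition mistake_function :: "(nat \<Rightarrow> real \<Rightarrow> nat) \<Rightarrow> bool" where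
  "mistake_function g \<longleftrightarrow>
     (\<exists>\<epsilon>\<^sub>0>0.
        (\<forall>\<epsilon>\<in>{0<..\<epsilon>\<^sub>0}.
           (\<forall>n\<ge>1. 1 \<le> g n \<epsilon>) \<and>
           (\<forall>n\<ge>1. g n \<epsilon> \<le> g (n + 1) \<epsilon>) \<and>
           (\<lambda>n. real (g n \<epsilon>) / real n) \<longlonglongrightarrow> 0) \<and>
        (\<forall>\<epsilon>>\<epsilon>\<^sub>0. \<forall>n\<ge>1. g n \<epsilon> = g n \<epsilon>\<^sub>0))"

definition mistake_ball ::
  "('a::metric_space \<Rightarrow> 'a) \<Rightarrow> (nat \<Rightarrow> real \<Rightarrow> nat) \<Rightarrow> nat \<Rightarrow> 'a \<Rightarrow> real \<Rightarrow> 'a set" where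
  "mistake_ball T g n x \<epsilon> =
     {y. \<exists>\<Lambda>\<subseteq>{..<n}. card \<Lambda> \<ge> n - g n \<epsilon> \<and> (\<forall>j\<in>\<Lambda>. dist ((T ^^ j) x) ((T ^^ j) y) \<le> \<epsilon>)}"

text \<open>
  The families \<open>\<epsilon>\<close>, \<open>x\<close>, \<open>n\<close> matter only at the indices \<open>1, \<dots>, m\<close>; the sum over
  \<open>{1..<j}\<close> is \<open>n\<^sub>0 + n\<^sub>1 + \<dots> + n\<^bsub>j-1\<^esub>\<close> with \<open>n\<^sub>0 = 0\<close>.
\<close>

definition almost_specification :: "('a::metric_space \<Rightarrow> 'a) \<Rightarrow> bool" where
  "almost_specification T \<longleftrightarrow>
     (\<exists>g k. mistake_function g \<and>
        (\<forall>\<epsilon>>0. 1 \<le> k \<epsilon> \<and> (\<forall>n\<ge>k \<epsilon>. g n \<epsilon> < n)) \<and>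
        (\<forall>m\<ge>1. \<forall>(\<epsilon> :: nat \<Rightarrow> real) (x :: nat \<Rightarrow> 'a) (n :: nat \<Rightarrow> nat).
           (\<forall>j\<in>{1..m}. \<epsilon> j > 0 \<and> n j \<ge> k (\<epsilon> j)) \<longrightarrow>
           (\<Inter>j\<in>{1..m}. (T ^^ (\<Sum>i\<in>{1..<j}. n i)) -` mistake_ball T g (n j) (x j) (\<epsilon> j)) \<noteq> {}))"


subsection \<open>Vague specification\<close>

definition density_one :: "nat set \<Rightarrow> bool" where
  "density_one A \<longleftrightarrow> (\<lambda>n. real (card (A \<inter> {0..<n})) / real n) \<longlonglongrightarrow> 1"

definition shift :: "(nat \<Rightarrow> 'a) \<Rightarrow> (nat \<Rightarrow> 'a)" where
  "shift x = (\<lambda>n. x (n + 1))"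

definition orbit_set :: "('a \<Rightarrow> 'a) \<Rightarrow> (nat \<Rightarrow> 'a) set" where
  "orbit_set T = range (\<lambda>z n. (T ^^ n) z)"

definition vague_pseudo_orbit :: "('a::topological_space \<Rightarrow> 'a) \<Rightarrow> (nat \<Rightarrow> 'a) \<Rightarrow> bool" where
  "vague_pseudo_orbit T x \<longleftrightarrow>
     (\<forall>U. open U \<and> orbit_set T \<subseteq> U \<longrightarrow> density_one {n. (shift ^^ n) x \<in> U})"

definition vague_specification :: "('a::metric_space \<Rightarrow> 'a) \<Rightarrow> bool" where
  "vague_specification T \<longleftrightarrow>
     (\<forall>x. vague_pseudo_orbit T x \<longrightarrow>
        (\<exists>z. \<forall>\<epsilon>>0. density_one {n. dist ((T ^^ n) z) (x n) < \<epsilon>}))"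

end

theory Submission
  imports Defs
begin

text \<open>
  Fix a vague pseudo-orbit \<open>x\<close>. For each level \<open>p\<close> choose a length \<open>L p\<close> for which at most a
  fraction \<open>1/(p+1)\<close> of mistakes is allowed at precision \<open>1/(p+1)\<close>. For density-one many
  \<open>s\<close> the window of \<open>x\<close> of length \<open>L p\<close> at \<open>s\<close> is traced by a true orbit. Let the level grow
  slowly with the position and cut \<open>x\<close> greedily into blocks: at a position whose window is traced
  take this whole window, otherwise advance by a junk block of the fixed length \<open>k 1\<close>, the least
  length which almost specification admits at precision \<open>1\<close>. Each junk block is charged to
  the bad position at which it starts, so junk has density zero. Almost specification and
  compactness give a point following all blocks.
\<close>

subsection \<open>Sets of density zero\<close>

definition density_zero :: "nat set \<Rightarrow> bool" where
  "density_zero A \<longleftrightarrow> (\<lambda>n. real (card (A \<inter> {0..<n})) / real n) \<longlonglongrightarrow> 0"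

text \<open>The error positions are what gets counted, and upper bounds on them add up over blocks;
  hence the passage to complements.\<close>

lemma density_one_iff_Compl: "density_one A \<longleftrightarrow> density_zero (- A)"
proof -
  have card: "real (card (A \<inter> {0..<n})) + real (card (- A \<inter> {0..<n})) = real n" for n
  proof -
    have "card ((A \<inter> {0..<n}) \<union> (- A \<inter> {0..<n})) = card (A \<inter> {0..<n}) + card (- A \<inter> {0..<n})"
      by (rule card_Un_disjoint) auto
    moreover have "(A \<inter> {0..<n}) \<union> (- A \<inter> {0..<n}) = {0..<n}"
      by auto
    ultimately show ?thesis
      by simp
  qed
  have "\<forall>\<^sub>F n in sequentially. 1 - real (card (- A \<inter> {0..<n})) / real n = real (card (A \<inter> {0..<n})) / real n"
    using eventually_gt_at_top[of 0]
  proof eventually_elim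
    case (elim n)
    with card[of n] show ?case
      by (simp add: field_simps)
  qed
  then have "density_one A \<longleftrightarrow> (\<lambda>n. 1 - real (card (- A \<inter> {0..<n})) / real n) \<longlonglongrightarrow> 1"
    unfolding density_one_def by (intro tendsto_cong) (auto elim: eventually_mono)
  also have "\<dots> \<longleftrightarrow> density_zero (- A)"
  proof
    assume "(\<lambda>n. 1 - real (card (- A \<inter> {0..<n})) / real n) \<longlonglongrightarrow> 1"
    from tendsto_diff[OF tendsto_const[of 1] this] show "density_zero (- A)"
      by (simp add: density_zero_def)
  next
    assume "density_zero (- A)"
    then have "(\<lambda>n. real (card (- A \<inter> {0..<n})) / real n) \<longlonglongrightarrow> 0"
      by (simp add: density_zero_def)
    from tendsto_diff[OF tendsto_const[of 1] this]
    show "(\<lambda>n. 1 - real (card (- A \<inter> {0..<n})) / real n) \<longlonglongrightarrow> 1"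
      by simp
  qed
  finally show ?thesis .
qed

text \<open>Clearing the denominator leaves linear bounds that can be summed and that make sense at
  \<open>n = 0\<close> as well.\<close>

lemma density_zero_iff:
  "density_zero A \<longleftrightarrow> (\<forall>\<eta>>0. \<forall>\<^sub>F n in sequentially. real (card (A \<inter> {0..<n})) \<le> \<eta> * real n)"
proof
  assume zero: "density_zero A"
  show "\<forall>\<eta>>0. \<forall>\<^sub>F n in sequentially. real (card (A \<inter> {0..<n})) \<le> \<eta> * real n"
  proof (intro allI impI)
    fix \<eta> :: real
    assume "\<eta> > 0"
    with zero have "\<forall>\<^sub>F n in sequentially. real (card (A \<inter> {0..<n})) / real n < \<eta>"
      unfolding density_zero_def by (rule order_tendstoD)
    then show "\<forall>\<^sub>F n in sequentially. real (card (A \<inter> {0..<n})) \<le> \<eta> * real n"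
      using eventually_gt_at_top[of 0] by eventually_elim (simp add: field_simps)
  qed
next
  assume *: "\<forall>\<eta>>0. \<forall>\<^sub>F n in sequentially. real (card (A \<inter> {0..<n})) \<le> \<eta> * real n"
  show "density_zero A"
    unfolding density_zero_def
  proof (rule tendstoI)
    fix e :: real
    assume "e > 0"
    then have "\<forall>\<^sub>F n in sequentially. real (card (A \<inter> {0..<n})) \<le> (e / 2) * real n"
      using *[rule_format, of "e / 2"] by simp
    then show "\<forall>\<^sub>F n in sequentially. dist (real (card (A \<inter> {0..<n})) / real n) 0 < e"
      using eventually_gt_at_top[of 0]
    proof eventually_elim
      case (elim n)
      then have "real (card (A \<inter> {0..<n})) / real n \<le> e / 2"
        by (simp add: field_simps)
      also have "\<dots> < e"
        using \<open>e > 0\<close> by simp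
      finally show ?case
        by simp
    qed
  qed
qed

text \<open>The initial segment costs at most \<open>m\<close>, which is below half of the allowed
  share once \<open>n\<close> reaches \<open>2 * m / \<eta>\<close>. This later allows early blocks
  to be treated as bad.\<close>

lemma density_zero_Un_lessThan:
  assumes "density_zero A"
  shows "density_zero (A \<union> {..<m})"
  unfolding density_zero_iff
proof (intro allI impI)
  fix \<eta> :: real
  assume "\<eta> > 0"
  then have "\<forall>\<^sub>F n in sequentially. real (card (A \<inter> {0..<n})) \<le> \<eta> / 2 * real n"
    using assms[unfolded density_zero_iff, rule_format, of "\<eta> / 2"] by simp
  then show "\<forall>\<^sub>F n in sequentially. real (card ((A \<union> {..<m}) \<inter> {0..<n})) \<le> \<eta> * real n"
    using eventually_ge_at_top[of "nat \<lceil>2 * real m / \<eta>\<rceil>"]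
  proof eventually_elim
    case (elim n)
    have "card ((A \<union> {..<m}) \<inter> {0..<n}) \<le> card (A \<inter> {0..<n} \<union> {..<m})"
      by (rule card_mono) auto
    also have "\<dots> \<le> card (A \<inter> {0..<n}) + m"
      using card_Un_le[of "A \<inter> {0..<n}" "{..<m}"] by simp
    finally have "real (card ((A \<union> {..<m}) \<inter> {0..<n})) \<le> \<eta> / 2 * real n + real m"
      using elim by linarith
    moreover have "2 * real m / \<eta> \<le> real n"
      using elim by linarith
    then have "real m \<le> \<eta> / 2 * real n"
      using \<open>\<eta> > 0\<close> by (simp add: field_simps)
    ultimately show ?case
      by simp
  qed
qed

section \<open>Counting along a partition into blocks\<close>

lemma strict_mono_bracket:
  fixes s :: "nat \<Rightarrow> nat"
  assumes "strict_mono s" and "s 0 \<le> n"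
  obtains m where "s m \<le> n" "n < s (Suc m)"
proof -
  have ex: "n < s (Suc n)"
    using strict_mono_imp_increasing[OF assms(1), of "Suc n"] by simp
  define m where "m = (LEAST m. n < s m)"
  have "n < s m"
    unfolding m_def using ex by (rule LeastI)
  with assms(2) obtain m' where m': "m = Suc m'"
    by (cases m) auto
  have "\<not> n < s m'"
    using not_less_Least[of m' "\<lambda>m. n < s m"] m' m_def by simp
  with \<open>n < s m\<close> m' show thesis
    by (intro that[of m']) auto
qed

text \<open>Summing the block estimates up to \<open>s m\<close> gives a small share of
  \<open>s m\<close> plus \<open>K\<close> for each start in \<open>B\<close>. Distinct blocks have
  distinct starts, so the second term is at most \<open>K\<close> times a count of \<open>B\<close>,
  which is sublinear. The block cut off by \<open>n\<close> is counted in full; the length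
  hypothesis makes it small compared with its start, up to a constant.\<close>

lemma density_zero_blocks:
  fixes s :: "nat \<Rightarrow> nat"
  assumes s: "strict_mono s" "s 0 = 0"
    and len: "\<And>\<eta>. \<eta> > 0 \<Longrightarrow> \<exists>C. \<forall>i. real (s (Suc i)) - real (s i) \<le> \<eta> * real (s i) + C"
    and blocks: "\<And>\<eta>. \<eta> > 0 \<Longrightarrow> \<exists>K B. density_zero B \<and>
      (\<forall>i. real (card (E \<inter> {s i..<s (Suc i)})) \<le>
        \<eta> * (real (s (Suc i)) - real (s i)) + real K * of_bool (s i \<in> B))"
  shows "density_zero E"
  unfolding density_zero_iff
proof (intro allI impI)
  fix \<eta> :: real
  assume "\<eta> > 0"
  \<comment> \<open>Four error terms share the budget: the block shares, the last block, the starts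
    in \<open>B\<close>, and the constant \<open>C\<close>.\<close>
  then have eta: "\<eta> / 4 > 0"
    by simp
  obtain C where C: "\<And>i. real (s (Suc i)) - real (s i) \<le> \<eta> / 4 * real (s i) + C"
    using len[OF eta] by auto
  obtain K B where B: "density_zero B"
    and K: "\<And>i. real (card (E \<inter> {s i..<s (Suc i)})) \<le>
        \<eta> / 4 * (real (s (Suc i)) - real (s i)) + real K * of_bool (s i \<in> B)"
    using blocks[OF eta] by auto
  have less: "s i < s (Suc i)" for i
    using s(1) by (simp add: strict_mono_def)
  have count: "real (card (E \<inter> {0..<s m})) \<le> \<eta> / 4 * real (s m) + real K * real (card (B \<inter> {0..<s m}))" for m
  proof (induction m)
    case 0
    then show ?case
      by (simp add: s)
  next
    case (Suc m)
    have "E \<inter> {0..<s (Suc m)} = (E \<inter> {0..<s m}) \<union> (E \<inter> {s m..<s (Suc m)})"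
      using less[of m] by auto
    then have E: "card (E \<inter> {0..<s (Suc m)}) \<le> card (E \<inter> {0..<s m}) + card (E \<inter> {s m..<s (Suc m)})"
      by (metis card_Un_le)
    \<comment> \<open>The start \<open>s m\<close> is not below \<open>s m\<close> but is below
      \<open>s (Suc m)\<close>, so passing to the next block raises the count of \<open>B\<close> by
      at least one when \<open>s m\<close> is bad.\<close>
    have "(if s m \<in> B then insert (s m) (B \<inter> {0..<s m}) else B \<inter> {0..<s m}) \<subseteq> B \<inter> {0..<s (Suc m)}"
      using less[of m] by auto
    from card_mono[OF _ this]
    have "card (B \<inter> {0..<s m}) + of_bool (s m \<in> B) \<le> card (B \<inter> {0..<s (Suc m)})"
      by (auto split: if_splits)
    then have "real (card (B \<inter> {0..<s m})) + of_bool (s m \<in> B) \<le> real (card (B \<inter> {0..<s (Suc m)}))"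
      by (metis of_nat_add of_nat_le_iff of_nat_of_bool)
    then have "real K * (real (card (B \<inter> {0..<s m})) + of_bool (s m \<in> B))
        \<le> real K * real (card (B \<inter> {0..<s (Suc m)}))"
      by (rule mult_left_mono) simp
    with Suc.IH E K[of m] show ?case
      by (simp add: algebra_simps)
  qed
  have bound: "real (card (E \<inter> {0..<n})) \<le> \<eta> / 2 * real n + real K * real (card (B \<inter> {0..<n})) + C" for n
  proof -
    obtain m where m: "s m \<le> n" "n < s (Suc m)"
      using strict_mono_bracket[OF s(1), of n] s(2) by auto
    have "E \<inter> {0..<n} \<subseteq> (E \<inter> {0..<s m}) \<union> {s m..<s (Suc m)}"
      using m by auto
    from card_mono[OF _ this]
    have "card (E \<inter> {0..<n}) \<le> card ((E \<inter> {0..<s m}) \<union> {s m..<s (Suc m)})"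
      by simp
    also have "\<dots> \<le> card (E \<inter> {0..<s m}) + (s (Suc m) - s m)"
      by (metis card_Un_le card_atLeastLessThan)
    finally have "real (card (E \<inter> {0..<n})) \<le> real (card (E \<inter> {0..<s m})) + (real (s (Suc m)) - real (s m))"
      using less[of m] by linarith
    also have "\<dots> \<le> \<eta> / 2 * real (s m) + real K * real (card (B \<inter> {0..<s m})) + C"
      using count[of m] C[of m] by (simp add: algebra_simps)
    also have "\<dots> \<le> \<eta> / 2 * real n + real K * real (card (B \<inter> {0..<n})) + C"
      using m \<open>\<eta> > 0\<close> by (intro add_mono mult_left_mono of_nat_mono card_mono) auto
    finally show ?thesis .
  qed
  \<comment> \<open>The summand \<open>1\<close> guards against \<open>K = 0\<close>.\<close>
  have "\<eta> / (4 * (real K + 1)) > 0"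
    using \<open>\<eta> > 0\<close> by simp
  then have "\<forall>\<^sub>F n in sequentially. real (card (B \<inter> {0..<n})) \<le> \<eta> / (4 * (real K + 1)) * real n"
    using B unfolding density_zero_iff by blast
  then show "\<forall>\<^sub>F n in sequentially. real (card (E \<inter> {0..<n})) \<le> \<eta> * real n"
    using eventually_ge_at_top[of "nat \<lceil>4 * C / \<eta>\<rceil>"]
  proof eventually_elim
    case (elim n)
    have "4 * C / \<eta> \<le> real n"
      using elim by linarith
    then have "C \<le> \<eta> / 4 * real n"
      using \<open>\<eta> > 0\<close> by (simp add: field_simps)
    moreover have "real K * real (card (B \<inter> {0..<n})) \<le> \<eta> / 4 * real n"
    proof -
      have "real K * real (card (B \<inter> {0..<n})) \<le> (real K + 1) * (\<eta> / (4 * (real K + 1)) * real n)"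
        using elim by (intro mult_mono) auto
      also have "\<dots> = \<eta> / 4 * real n"
        by (simp add: divide_simps)
      finally show ?thesis .
    qed
    ultimately show ?case
      using bound[of n] by linarith
  qed
qed

section \<open>Diagonal choice of a slowly growing level\<close>

text \<open>Take the largest \<open>p \<le> n\<close> for which \<open>Q p\<close> holds from
  \<open>n\<close> on. Requiring it at all later positions makes the candidate sets increase, hence
  \<open>l\<close> monotone; the bound \<open>p \<le> n\<close> keeps them finite, and
  \<open>Q0\<close> keeps them nonempty.\<close>

lemma diagonal_level:
  fixes Q :: "nat \<Rightarrow> nat \<Rightarrow> bool"
  assumes ev: "\<And>p. eventually (Q p) sequentially" and Q0: "\<And>n. Q 0 n"
  obtains l where "mono l" "filterlim l at_top sequentially" "\<And>n. Q (l n) n"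
proof -
  define P where "P n = {p. p \<le> n \<and> (\<forall>t\<ge>n. Q p t)}" for n
  define l where "l n = Max (P n)" for n
  have fin: "finite (P n)" for n
    unfolding P_def by (rule finite_subset[of _ "{..n}"]) auto
  have zero: "0 \<in> P n" for n
    by (simp add: P_def Q0)
  have mem: "l n \<in> P n" for n
    unfolding l_def using Max_in[OF fin] zero by blast
  have "mono l"
  proof (rule monoI)
    fix m n :: nat
    assume "m \<le> n"
    then have "P m \<subseteq> P n"
      by (auto simp: P_def)
    then show "l m \<le> l n"
      unfolding l_def using zero fin by (intro Max_mono) auto
  qed
  moreover have "filterlim l at_top sequentially"
    unfolding filterlim_at_top
  proof
    fix p
    obtain N where "\<And>t. t \<ge> N \<Longrightarrow> Q p t"
      using ev[of p] by (auto simp: eventually_sequentially)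
    then have "p \<in> P n" if "n \<ge> max N p" for n
      using that by (auto simp: P_def)
    then show "\<forall>\<^sub>F n in sequentially. p \<le> l n"
      unfolding eventually_sequentially l_def using Max_ge[OF fin] by blast
  qed
  moreover have "Q (l n) n" for n
    using mem[of n] by (simp add: P_def)
  ultimately show thesis
    by (rule that)
qed

text \<open>As \<open>A\<close> and \<open>l\<close> are monotone, the diagonal set below
  \<open>n\<close> lies in \<open>A (l n)\<close>, whose share there is at most
  \<open>1 / (l n + 1)\<close>. The bound on \<open>f\<close> will make window lengths negligible
  compared with their positions.\<close>

lemma density_zero_diagonal:
  fixes A :: "nat \<Rightarrow> nat set" and f :: "nat \<Rightarrow> nat"
  assumes "mono A" and zero: "\<And>p. density_zero (A p)"
  obtains l where "filterlim l at_top sequentially" "\<And>n. l n * f (l n) \<le> n"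
    "density_zero {n. n \<in> A (l n)}"
proof -
  define Q where "Q p n \<longleftrightarrow> p * f p \<le> n \<and> real (card (A p \<inter> {0..<n})) \<le> 1 / (real p + 1) * real n" for p n
  have "eventually (Q p) sequentially" for p
    unfolding Q_def
    using zero[of p, unfolded density_zero_iff, rule_format, of "1 / (real p + 1)"]
    by (intro eventually_conj eventually_ge_at_top) auto
  \<comment> \<open>At level \<open>0\<close> the product is \<open>0\<close> and the permitted
    share is everything.\<close>
  moreover have "Q 0 n" for n
    using card_mono[of "{0..<n}" "A 0 \<inter> {0..<n}"] by (simp add: Q_def)
  ultimately obtain l where l: "mono l" "filterlim l at_top sequentially" "\<And>n. Q (l n) n"
    using diagonal_level[of Q] by blast
  have "density_zero {n. n \<in> A (l n)}"
    unfolding density_zero_iff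
  proof (intro allI impI)
    fix \<eta> :: real
    assume "\<eta> > 0"
    have "\<forall>\<^sub>F n in sequentially. nat \<lceil>1 / \<eta>\<rceil> \<le> l n"
      using l(2) unfolding filterlim_at_top by blast
    then show "\<forall>\<^sub>F n in sequentially. real (card ({n. n \<in> A (l n)} \<inter> {0..<n})) \<le> \<eta> * real n"
    proof eventually_elim
      case (elim n)
      have "{n. n \<in> A (l n)} \<inter> {0..<n} \<subseteq> A (l n) \<inter> {0..<n}"
      proof
        fix i
        assume i: "i \<in> {n. n \<in> A (l n)} \<inter> {0..<n}"
        then have "l i \<le> l n"
          using monoD[OF l(1)] by simp
        then have "A (l i) \<subseteq> A (l n)"
          by (rule monoD[OF \<open>mono A\<close>])
        with i show "i \<in> A (l n) \<inter> {0..<n}"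
          by auto
      qed
      then have "card ({n. n \<in> A (l n)} \<inter> {0..<n}) \<le> card (A (l n) \<inter> {0..<n})"
        by (intro card_mono) auto
      then have "real (card ({n. n \<in> A (l n)} \<inter> {0..<n})) \<le> 1 / (real (l n) + 1) * real n"
        using l(3)[of n] by (simp add: Q_def)
      also have "1 / \<eta> \<le> real (l n)"
        using elim by linarith
      then have "1 / (real (l n) + 1) * real n \<le> \<eta> * real n"
        using \<open>\<eta> > 0\<close> by (intro mult_right_mono) (auto simp: field_simps)
      finally show ?case .
    qed
  qed
  with l that show thesis
    by (auto simp: Q_def)
qed


subsection \<open>Windows of a vague pseudo-orbit\<close>

lemma funpow_shift: "(shift ^^ n) x = (\<lambda>i. x (n + i))"
  by (induction n) (auto simp: shift_def)

text \<open>Only finitely many coordinates are constrained, so each \<open>z\<close> contributes an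
  open cylinder.\<close>

lemma open_finite_trace:
  fixes T :: "'a::metric_space \<Rightarrow> 'a"
  shows "open {y :: nat \<Rightarrow> 'a. \<exists>z. \<forall>i<L. dist ((T ^^ i) z) (y i) < e}"
proof -
  have eq: "{y :: nat \<Rightarrow> 'a. \<exists>z. \<forall>i<L. dist ((T ^^ i) z) (y i) < e} =
      (\<Union>z. \<Inter>i\<in>{..<L}. (\<lambda>y. y i) -` ball ((T ^^ i) z) e)"
    by auto (metis lessThan_iff)+
  have "open ((\<lambda>y :: nat \<Rightarrow> 'a. y i) -` ball a e)" for i a
    by (rule open_vimage[OF open_ball continuous_on_product_coordinates])
  then show ?thesis
    unfolding eq by (intro open_UN open_INT ballI) auto
qed

text \<open>Demanding every level \<open>q \<le> p\<close>, with a tracing point that may depend on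
  \<open>q\<close>, makes these sets decrease in \<open>p\<close>, as the diagonal choice needs for
  their complements.\<close>

definition traced_windows ::
  "('a::metric_space \<Rightarrow> 'a) \<Rightarrow> (nat \<Rightarrow> 'a) \<Rightarrow> (nat \<Rightarrow> nat) \<Rightarrow> nat \<Rightarrow> nat set" where
  "traced_windows T x L p =
     {s. \<forall>q\<le>p. \<exists>z. \<forall>i<L q. dist ((T ^^ i) z) (x (s + i)) < 1 / (real q + 1)}"

text \<open>The condition defines an open set of sequences, and a true orbit satisfies it by tracing
  itself with error \<open>0\<close>.\<close>

lemma density_one_traced_windows:
  fixes T :: "'a::metric_space \<Rightarrow> 'a"
  assumes "vague_pseudo_orbit T x"
  shows "density_one (traced_windows T x L p)"
proof -
  define U where "U = (\<Inter>q\<in>{..p}. {y :: nat \<Rightarrow> 'a. \<exists>z. \<forall>i<L q. dist ((T ^^ i) z) (y i) < 1 / (real q + 1)})"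
  have "open U"
    unfolding U_def by (intro open_INT ballI open_finite_trace) auto
  moreover have "orbit_set T \<subseteq> U"
  proof
    fix y
    assume "y \<in> orbit_set T"
    then obtain z where y: "y = (\<lambda>n. (T ^^ n) z)"
      by (auto simp: orbit_set_def)
    then have "dist ((T ^^ i) z) (y i) < 1 / (real q + 1)" for i q
      by simp
    then show "y \<in> U"
      unfolding U_def by blast
  qed
  ultimately have "density_one {n. (shift ^^ n) x \<in> U}"
    using assms by (auto simp: vague_pseudo_orbit_def)
  moreover have "{n. (shift ^^ n) x \<in> U} = traced_windows T x L p"
    by (auto simp: U_def traced_windows_def funpow_shift)
  ultimately show ?thesis
    by simp
qed


subsection \<open>Shadowing infinitely many blocks\<close>

text \<open>Above the threshold the values are those at the threshold for all
  \<open>n \<ge> 1\<close>, so the limit carries over.\<close>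

lemma mistake_function_tendsto:
  assumes "mistake_function g" and "\<epsilon> > 0"
  shows "(\<lambda>n. real (g n \<epsilon>) / real n) \<longlonglongrightarrow> 0"
proof -
  obtain \<epsilon>\<^sub>0 where e0: "\<epsilon>\<^sub>0 > 0"
    and small: "\<forall>\<epsilon>\<in>{0<..\<epsilon>\<^sub>0}. (\<forall>n\<ge>1. 1 \<le> g n \<epsilon>) \<and> (\<forall>n\<ge>1. g n \<epsilon> \<le> g (n + 1) \<epsilon>) \<and>
      (\<lambda>n. real (g n \<epsilon>) / real n) \<longlonglongrightarrow> 0"
    and const: "\<forall>\<epsilon>>\<epsilon>\<^sub>0. \<forall>n\<ge>1. g n \<epsilon> = g n \<epsilon>\<^sub>0"
    using assms(1) unfolding mistake_function_def by (elim exE conjE)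
  have lim: "(\<lambda>n. real (g n \<epsilon>) / real n) \<longlonglongrightarrow> 0" if "\<epsilon> \<in> {0<..\<epsilon>\<^sub>0}" for \<epsilon>
    using bspec[OF small that] by (elim conjE)
  show ?thesis
  proof (cases "\<epsilon> \<le> \<epsilon>\<^sub>0")
    case True
    with assms(2) show ?thesis
      by (intro lim) auto
  next
    case False
    have "\<forall>\<^sub>F n in sequentially. real (g n \<epsilon>\<^sub>0) / real n = real (g n \<epsilon>) / real n"
      using eventually_ge_at_top[of 1] by eventually_elim (use False const in simp)
    with lim[of \<epsilon>\<^sub>0] e0 show ?thesis
      by (auto intro: Lim_transform_eventually)
  qed
qed

section \<open>From finitely many blocks to infinitely many\<close>

lemma continuous_on_funpow:
  assumes "continuous_on UNIV (T :: 'a::topological_space \<Rightarrow> 'a)"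
  shows "continuous_on UNIV (T ^^ n)"
proof (induction n)
  case 0
  then show ?case
    by (simp add: id_def)
next
  case (Suc n)
  have "continuous_on UNIV (T \<circ> (T ^^ n))"
    by (rule continuous_on_compose[OF Suc continuous_on_subset[OF assms]]) simp
  then show ?case
    by simp
qed

text \<open>There are finitely many choices of the set of good times, and for each of them the
  non-strict inequalities cut out a closed set.\<close>

lemma closed_mistake_ball:
  assumes "continuous_on UNIV T"
  shows "closed (mistake_ball T g n x \<epsilon>)"
proof -
  have eq: "mistake_ball T g n x \<epsilon> =
      (\<Union>\<Lambda>\<in>{\<Lambda>. \<Lambda> \<subseteq> {..<n} \<and> card \<Lambda> \<ge> n - g n \<epsilon>}. \<Inter>j\<in>\<Lambda>. (T ^^ j) -` cball ((T ^^ j) x) \<epsilon>)"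
    unfolding mistake_ball_def by auto
  have "finite {\<Lambda>. \<Lambda> \<subseteq> {..<n} \<and> card \<Lambda> \<ge> n - g n \<epsilon>}"
    by (rule finite_subset[of _ "Pow {..<n}"]) auto
  then show ?thesis
    unfolding eq
    by (intro closed_UN closed_INT ballI closed_vimage closed_cball continuous_on_funpow assms)
qed

text \<open>The constraints of the single blocks are closed sets; almost specification gives them
  the finite intersection property, and compactness does the rest.\<close>

lemma infinite_almost_specification:
  fixes T :: "'a::metric_space \<Rightarrow> 'a" and \<epsilon> :: "nat \<Rightarrow> real" and x :: "nat \<Rightarrow> 'a" and n :: "nat \<Rightarrow> nat"
  assumes compact: "compact (UNIV :: 'a set)" and cont: "continuous_on UNIV T"
    and spec: "\<And>(m :: nat) (\<epsilon> :: nat \<Rightarrow> real) (x :: nat \<Rightarrow> 'a) (n :: nat \<Rightarrow> nat). m \<ge> 1 \<Longrightarrow> \<forall>j\<in>{1..m}. \<epsilon> j > 0 \<and> n j \<ge> k (\<epsilon> j) \<Longrightarrow>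
      (\<Inter>j\<in>{1..m}. (T ^^ (\<Sum>i\<in>{1..<j}. n i)) -` mistake_ball T g (n j) (x j) (\<epsilon> j)) \<noteq> {}"
    and pos: "\<And>i. \<epsilon> i > 0" and long: "\<And>i. n i \<ge> k (\<epsilon> i)"
  obtains z where "\<And>i. (T ^^ (\<Sum>j<i. n j)) z \<in> mistake_ball T g (n i) (x i) (\<epsilon> i)"
proof -
  define C where "C i = (T ^^ (\<Sum>j<i. n j)) -` mistake_ball T g (n i) (x i) (\<epsilon> i)" for i
  have closed: "closed (C i)" for i
    unfolding C_def by (intro closed_vimage closed_mistake_ball continuous_on_funpow cont)
  have "UNIV \<inter> (\<Inter>i\<in>UNIV. C i) \<noteq> {}"
  proof (rule compact_imp_fip_image[OF compact])
    fix I :: "nat set"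
    assume "finite I"
    then obtain m where m: "I \<subseteq> {..<m}"
      by (meson finite_nat_iff_bounded)
    \<comment> \<open>Almost specification numbers blocks from \<open>1\<close>, the sequence here
      from \<open>0\<close>. Below, \<open>Suc m\<close> blocks are used so that their number is
      positive.\<close>
    have sum: "(\<Sum>i\<in>{1..<Suc j}. n (i - 1)) = (\<Sum>i<j. n i)" for j
      using sum.shift_bounds_Suc_ivl[of "\<lambda>i. n (i - 1)" 0 j] by (simp add: lessThan_atLeast0)
    have "(\<Inter>j\<in>{1..Suc m}. (T ^^ (\<Sum>i\<in>{1..<j}. n (i - 1))) -`
        mistake_ball T g (n (j - 1)) (x (j - 1)) (\<epsilon> (j - 1))) \<noteq> {}"
      using pos long by (intro spec[of "Suc m" "\<lambda>j. \<epsilon> (j - 1)" "\<lambda>j. n (j - 1)" "\<lambda>j. x (j - 1)"]) auto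
    then obtain z where z: "\<And>j. j \<in> {1..Suc m} \<Longrightarrow> (T ^^ (\<Sum>i\<in>{1..<j}. n (i - 1))) z \<in>
        mistake_ball T g (n (j - 1)) (x (j - 1)) (\<epsilon> (j - 1))"
      by blast
    have "z \<in> C i" if "i < m" for i
      using z[of "Suc i"] that unfolding C_def sum by simp
    with m show "UNIV \<inter> (\<Inter>i\<in>I. C i) \<noteq> {}"
      by blast
  qed (rule closed)
  then obtain z where "\<And>i. z \<in> C i"
    by blast
  then show thesis
    by (intro that[of z]) (simp add: C_def)
qed

text \<open>At the good times of the mistake ball, the triangle inequality through the orbit of
  \<open>y\<close> gives an error below \<open>2 * e\<close>. So failures occur only at the
  remaining times, at most \<open>g n e\<close> of them.\<close>

lemma card_untraced_block:
  fixes T :: "'a::metric_space \<Rightarrow> 'a"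
  assumes ball: "(T ^^ s) z \<in> mistake_ball T g n y e"
    and trace: "\<And>i. i < n \<Longrightarrow> dist ((T ^^ i) y) (x (s + i)) < e" and "2 * e \<le> \<epsilon>"
  shows "card ({i. \<not> dist ((T ^^ i) z) (x i) < \<epsilon>} \<inter> {s..<s + n}) \<le> g n e"
proof -
  obtain \<Lambda> where L: "\<Lambda> \<subseteq> {..<n}" "card \<Lambda> \<ge> n - g n e"
    and close: "\<And>j. j \<in> \<Lambda> \<Longrightarrow> dist ((T ^^ j) y) ((T ^^ j) ((T ^^ s) z)) \<le> e"
    using ball unfolding mistake_ball_def by auto
  have "{i. \<not> dist ((T ^^ i) z) (x i) < \<epsilon>} \<inter> {s..<s + n} \<subseteq> (+) s ` ({..<n} - \<Lambda>)"
  proof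
    fix i
    assume i: "i \<in> {i. \<not> dist ((T ^^ i) z) (x i) < \<epsilon>} \<inter> {s..<s + n}"
    define j where "j = i - s"
    have j: "i = s + j" "j < n"
      using i by (auto simp: j_def)
    have "j \<notin> \<Lambda>"
    proof
      assume "j \<in> \<Lambda>"
      have "(T ^^ j) ((T ^^ s) z) = (T ^^ i) z"
        by (simp add: j funpow_add add.commute)
      with close[OF \<open>j \<in> \<Lambda>\<close>] have "dist ((T ^^ i) z) ((T ^^ j) y) \<le> e"
        by (simp add: dist_commute)
      moreover have "dist ((T ^^ j) y) (x i) < e"
        using trace j by simp
      ultimately have "dist ((T ^^ i) z) (x i) < \<epsilon>"
        using dist_triangle[of "(T ^^ i) z" "x i" "(T ^^ j) y"] \<open>2 * e \<le> \<epsilon>\<close> by linarith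
      with i show False
        by simp
    qed
    with j show "i \<in> (+) s ` ({..<n} - \<Lambda>)"
      by auto
  qed
  then have "card ({i. \<not> dist ((T ^^ i) z) (x i) < \<epsilon>} \<inter> {s..<s + n}) \<le> card ((+) s ` ({..<n} - \<Lambda>))"
    by (intro card_mono) auto
  also have "\<dots> \<le> card ({..<n} - \<Lambda>)"
    by (intro card_image_le) auto
  also have "\<dots> = n - card \<Lambda>"
    using L(1) by (subst card_Diff_subset) (auto intro: finite_subset)
  also have "\<dots> \<le> g n e"
    using L(2) by linarith
  finally show ?thesis .
qed

section \<open>Construction of the shadowing point and count of its errors\<close>

theorem corollary7p9:
  fixes T :: "'a::metric_space \<Rightarrow> 'a"
  assumes "topological_dynamical_system T"
    and "diameter (UNIV :: 'a set) \<le> 1"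
    and "almost_specification T"
  shows "vague_specification T"
  unfolding vague_specification_def
proof (intro allI impI)
  fix x
  assume x: "vague_pseudo_orbit T x"
  have compact: "compact (UNIV :: 'a set)" and cont: "continuous_on UNIV T"
    using assms(1) by (auto simp: topological_dynamical_system_def)
  obtain g k where g: "mistake_function g" and k_ge: "\<forall>\<epsilon>>0. 1 \<le> k \<epsilon> \<and> (\<forall>n\<ge>k \<epsilon>. g n \<epsilon> < n)"
    and spec: "\<forall>m\<ge>1. \<forall>(\<epsilon> :: nat \<Rightarrow> real) (x :: nat \<Rightarrow> 'a) (n :: nat \<Rightarrow> nat).
      (\<forall>j\<in>{1..m}. \<epsilon> j > 0 \<and> n j \<ge> k (\<epsilon> j)) \<longrightarrow>
      (\<Inter>j\<in>{1..m}. (T ^^ (\<Sum>i\<in>{1..<j}. n i)) -` mistake_ball T g (n j) (x j) (\<epsilon> j)) \<noteq> {}"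
    using assms(3) unfolding almost_specification_def by (elim exE conjE)
  have k: "k \<epsilon> \<ge> 1" if "\<epsilon> > 0" for \<epsilon>
    using k_ge that by blast
  \<comment> \<open>\<open>e p\<close> serves both as the precision at level \<open>p\<close> and as
    the share of mistakes tolerated there.\<close>
  define e where "e p = 1 / (real p + 1)" for p :: nat
  have e: "e p > 0" for p
    by (simp add: e_def)
  have "\<exists>n. n \<ge> k (e p) \<and> real (g n (e p)) \<le> e p * real n" for p
  proof -
    have "\<forall>\<^sub>F n in sequentially. real (g n (e p)) / real n < e p"
      using mistake_function_tendsto[OF g e] e by (rule order_tendstoD)
    then have "\<forall>\<^sub>F n in sequentially. n \<ge> k (e p) \<and> real (g n (e p)) \<le> e p * real n"
      using eventually_ge_at_top[of "k (e p)"] eventually_gt_at_top[of 0]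
      by eventually_elim (simp add: field_simps)
    then show ?thesis
      by (rule eventually_happens'[OF sequentially_bot])
  qed
  then obtain L where L: "\<And>p. L p \<ge> k (e p)" "\<And>p. real (g (L p) (e p)) \<le> e p * real (L p)"
    by metis
  define G where "G = traced_windows T x L"
  have "mono (\<lambda>p. - G p)"
    unfolding G_def traced_windows_def by (rule monoI) (use order_trans in blast)
  moreover have "density_zero (- G p)" for p
    using density_one_traced_windows[OF x] by (simp add: G_def density_one_iff_Compl)
  ultimately obtain l where l: "filterlim l at_top sequentially" "\<And>n. l n * L (l n) \<le> n"
    and bad: "density_zero {n. n \<in> - G (l n)}"
    using density_zero_diagonal[of "\<lambda>p. - G p" L] by blast
  define len where "len s = (if s \<in> G (l s) then L (l s) else k 1)" for s
  define prec where "prec s = (if s \<in> G (l s) then e (l s) else 1)" for s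
  \<comment> \<open>With the implication under the quantifier, choice yields a total
    \<open>y\<close>; its values at bad positions are arbitrary and only fill the junk
    blocks.\<close>
  have "\<exists>z. s \<in> G (l s) \<longrightarrow> (\<forall>i<L (l s). dist ((T ^^ i) z) (x (s + i)) < e (l s))" for s
    unfolding G_def traced_windows_def e_def by blast
  then obtain y where y: "\<And>s i. s \<in> G (l s) \<Longrightarrow> i < L (l s) \<Longrightarrow> dist ((T ^^ i) (y s)) (x (s + i)) < e (l s)"
    by metis
  have prec: "prec s > 0" "len s \<ge> k (prec s)" for s
    using e L(1) by (auto simp: prec_def len_def)
  define s where "s i = ((\<lambda>t. t + len t) ^^ i) 0" for i
  have s0: "s 0 = 0" and sSuc: "s (Suc i) = s i + len (s i)" for i
    by (simp_all add: s_def)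
  have sum: "(\<Sum>j<i. len (s j)) = s i" for i
    by (induction i) (simp_all add: s0 sSuc)
  have "len t \<ge> 1" for t
    using prec[of t] k[of "prec t"] by linarith
  then have mono: "strict_mono s"
    by (simp add: strict_mono_Suc_iff sSuc Suc_le_eq)
  obtain z where z: "\<And>i. (T ^^ s i) z \<in> mistake_ball T g (len (s i)) (y (s i)) (prec (s i))"
    using infinite_almost_specification[OF compact cont spec[rule_format], where \<epsilon> = "\<lambda>i. prec (s i)"
        and n = "\<lambda>i. len (s i)" and x = "\<lambda>i. y (s i)"] prec sum by metis
  \<comment> \<open>From \<open>t0\<close> on the level exceeds \<open>c\<close>. The exceptional
    lengths are bounded: finitely many come before \<open>t0\<close>, and every bad position has
    length \<open>k 1\<close>.\<close>
  have large: "\<exists>t0 K. (\<forall>t\<ge>t0. real (l t) \<ge> c) \<and> (\<forall>t. t < t0 \<or> t \<notin> G (l t) \<longrightarrow> len t \<le> K)" for c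
  proof -
    obtain t0 where "\<And>t. t \<ge> t0 \<Longrightarrow> nat \<lceil>c\<rceil> \<le> l t"
      using l(1) unfolding filterlim_at_top eventually_sequentially by blast
    then have "\<forall>t\<ge>t0. real (l t) \<ge> c"
      by (meson of_nat_ceiling of_nat_mono order_trans)
    moreover have "len t \<le> Max (insert (k 1) (len ` {..<t0}))" if "t < t0 \<or> t \<notin> G (l t)" for t
    proof (rule Max_ge)
      show "len t \<in> insert (k 1) (len ` {..<t0})"
        using that by (cases "t < t0") (auto simp: len_def)
    qed simp
    ultimately show ?thesis
      by blast
  qed
  \<comment> \<open>The point \<open>z\<close> is fixed before \<open>\<epsilon>\<close>: since the
    level tends to infinity, all late traced blocks are precise enough for the given
    \<open>\<epsilon>\<close>.\<close>
  have "density_one {n. dist ((T ^^ n) z) (x n) < \<epsilon>}" if "\<epsilon> > 0" for \<epsilon>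
  proof -
    define E where "E = {n. \<not> dist ((T ^^ n) z) (x n) < \<epsilon>}"
    have "density_zero E"
    proof (rule density_zero_blocks[OF mono s0])
      fix \<eta> :: real
      assume "\<eta> > 0"
      obtain t0 K where t0: "\<And>t. t \<ge> t0 \<Longrightarrow> real (l t) \<ge> 1 / \<eta>"
        and K: "\<And>t. t < t0 \<or> t \<notin> G (l t) \<Longrightarrow> len t \<le> K"
        using large by metis
      have "real (len t) \<le> \<eta> * real t + real K" for t
      proof (cases "t < t0 \<or> t \<notin> G (l t)")
        case True
        then have "len t \<le> K"
          using K by blast
        moreover have "\<eta> * real t \<ge> 0"
          using \<open>\<eta> > 0\<close> by simp
        ultimately show ?thesis
          by linarith
      next
        case False
        \<comment> \<open>A late good window has \<open>l t \<ge> 1 / \<eta>\<close>, and the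
          diagonal bound \<open>l t * L (l t) \<le> t\<close> then keeps its length below
          \<open>\<eta> * t\<close>.\<close>
        then have "1 / \<eta> * real (len t) \<le> real (l t) * real (L (l t))"
          using t0[of t] \<open>\<eta> > 0\<close> by (intro mult_mono) (auto simp: len_def)
        also have "\<dots> \<le> real t"
          using l(2)[of t] by (metis of_nat_le_iff of_nat_mult)
        finally have "real (len t) \<le> \<eta> * real t"
          using \<open>\<eta> > 0\<close> by (simp add: field_simps)
        then show ?thesis
          by simp
      qed
      then show "\<exists>C. \<forall>i. real (s (Suc i)) - real (s i) \<le> \<eta> * real (s i) + C"
        by (auto simp: sSuc)
    next
      fix \<eta> :: real
      assume "\<eta> > 0"
      \<comment> \<open>Level \<open>1 / \<eta>\<close> brings the share of mistakes down to
        \<open>\<eta>\<close>; level \<open>2 / \<epsilon>\<close> brings twice the precision down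
        to \<open>\<epsilon>\<close>.\<close>
      obtain t0 K where t0: "\<And>t. t \<ge> t0 \<Longrightarrow> real (l t) \<ge> max (1 / \<eta>) (2 / \<epsilon>)"
        and K: "\<And>t. t < t0 \<or> t \<notin> G (l t) \<Longrightarrow> len t \<le> K"
        using large by metis
      define B where "B = {n. n \<in> - G (l n)} \<union> {..<t0}"
      have "density_zero B"
        unfolding B_def by (rule density_zero_Un_lessThan[OF bad])
      moreover have "real (card (E \<inter> {s i..<s (Suc i)})) \<le>
          \<eta> * (real (s (Suc i)) - real (s i)) + real K * of_bool (s i \<in> B)" for i
      proof (cases "s i \<in> B")
        case True
        \<comment> \<open>In a junk or early block every position is counted as an error.\<close>
        then have "len (s i) \<le> K"
          using K by (auto simp: B_def)
        moreover have "card (E \<inter> {s i..<s (Suc i)}) \<le> len (s i)"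
          using card_mono[of "{s i..<s (Suc i)}" "E \<inter> {s i..<s (Suc i)}"] by (simp add: sSuc)
        moreover have "\<eta> * real (len (s i)) \<ge> 0"
          using \<open>\<eta> > 0\<close> by simp
        ultimately show ?thesis
          using True by (simp add: sSuc)
      next
        case False
        then have good: "s i \<in> G (l (s i))" and "s i \<ge> t0"
          by (auto simp: B_def)
        then have len: "len (s i) = L (l (s i))" and prec: "prec (s i) = e (l (s i))"
          by (auto simp: len_def prec_def)
        have "real (l (s i)) \<ge> 1 / \<eta>" "real (l (s i)) \<ge> 2 / \<epsilon>"
          using t0[OF \<open>s i \<ge> t0\<close>] by auto
        then have small: "e (l (s i)) \<le> \<eta>" "2 * e (l (s i)) \<le> \<epsilon>"
          using \<open>\<eta> > 0\<close> \<open>\<epsilon> > 0\<close> by (auto simp: e_def field_simps)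
        have "card (E \<inter> {s i..<s (Suc i)}) \<le> g (len (s i)) (e (l (s i)))"
          unfolding E_def sSuc
          using z[of i] y[OF good] small(2) unfolding prec len
          by (intro card_untraced_block) auto
        then have "real (card (E \<inter> {s i..<s (Suc i)})) \<le> e (l (s i)) * real (len (s i))"
          using L(2)[of "l (s i)"] len by simp
        also have "\<dots> \<le> \<eta> * real (len (s i))"
          using small(1) by (rule mult_right_mono) simp
        finally show ?thesis
          using False by (simp add: sSuc)
      qed
      ultimately show "\<exists>K B. density_zero B \<and> (\<forall>i. real (card (E \<inter> {s i..<s (Suc i)})) \<le>
          \<eta> * (real (s (Suc i)) - real (s i)) + real K * of_bool (s i \<in> B))"
        by blast
    qed
    moreover have "- {n. dist ((T ^^ n) z) (x n) < \<epsilon>} = E"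
      by (auto simp: E_def)
    ultimately show ?thesis
      by (simp add: density_one_iff_Compl)
  qed
  then show "\<exists>z. \<forall>\<epsilon>>0. density_one {n. dist ((T ^^ n) z) (x n) < \<epsilon>}"
    by blast
qed

end
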